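(* Let $\mu_1,\mu_2>0$ and let $a>1$, $b>1$, $c\ge 0$ satisfy $(a-1)(b-1)\ge (c-1)^2$. Put $\theta=(\mu_1,\mu_2,a\mu_1^2,b\mu_2^2,c\mu_1\mu_2)$, assume the ambiguity set $\mathcal F(\theta)$ is non-empty, and let $q>0$. Let $$v_P(q;\theta)=\sup_{\mathbb P\in\mathcal F(\theta)}\mathbb E_{\mathbb P}\big[(X_1+X_2-q)_+\big].$$ Then: 1. if $Q_a\ge q$ and $Q_b\ge q$, then $v_P(q;\theta)=\mu_1+\mu_2-q\cdot\frac{a+b-2c}{ab-c^2}$; 2. if $Q_b<q$ and $Q_b\le\zeta_b$, then $v_P(q;\theta)=\frac{b-1}{2b}\left((q+Q_b)-\frac{b-c}{b-1}\mu_1\right)+\mu_1+\mu_2-q$; 3. if $Q_a<q$ and $Q_a\le\zeta_a$, then $v_P(q;\theta)=\frac{a-1}{2a}\left((q+Q_a)-\frac{a-c}{a-1}\mu_2\right)+\mu_1+\mu_2-q$; 4. if $Q_b<q$ and $Q_b\le-\zeta_b$, then $v_P(q;\theta)=\frac{b-1}{2b}\left(\frac{b-c}{b-1}\mu_1-(q-Q_b)\right)$; 5. if $Q_a<q$ and $Q_a\le-\zeta_a$, then $v_P(q;\theta)=\frac{a-1}{2a}\left(\frac{a-c}{a-1}\mu_2-(q-Q_a)\right)$; 6. if $Q_a>|\zeta_a|$ and $Q_b>|\zeta_b|$, then $v_P(q;\theta)=\frac12\left(Q_c-q+\mu_1+\mu_2\right)$.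
   Context: $(t)_+=\max\{t,0\}$. $\mathcal F(\theta)$ is the set of all probability distributions $\mathbb P$ of a random vector $(X_1,X_2)$ supported on $\mathbb R_+^2=[0,\infty)^2$ such that $\mathbb E_{\mathbb P}[X_1]=\mu_1$, $\mathbb E_{\mathbb P}[X_2]=\mu_2$, $\mathbb E_{\mathbb P}[X_1^2]=a\mu_1^2$, $\mathbb E_{\mathbb P}[X_2^2]=b\mu_2^2$, $\mathbb E_{\mathbb P}[X_1X_2]=c\mu_1\mu_2$. Notation: $$Q_a=\sqrt{q^2-2q\tfrac{a-c}{a-1}\mu_2+\tfrac{ab-c^2}{a-1}\mu_2^2},\quad Q_b=\sqrt{q^2-2q\tfrac{b-c}{b-1}\mu_1+\tfrac{ab-c^2}{b-1}\mu_1^2},$$ $$Q_c=\sqrt{q^2-2q(\mu_1+\mu_2)+a\mu_1^2+b\mu_2^2+2c\mu_1\mu_2},$$ $\zeta_a=a\mu_1+c\mu_2-q$, and $\zeta_b=c\mu_1+b\mu_2-q$.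
   Formalization: Item 1 is stated under the additional condition $ab\neq c^2$; when $ab=c^2$ (which forces $a=b=c$) one has $Q_a=Q_b=q$ and the quotient $\frac{a+b-2c}{ab-c^2}$ in item 1 reads $0/0$. *)

theory Defs
  imports "HOL-Probability.Probability"
begin

definition pos_part :: "real \<Rightarrow> real" where
  "pos_part t = max t 0"

(* The argument collects (E[X1], E[X2], E[X1^2], E[X2^2], E[X1 X2]).  A law of (X1, X2) is a Borel
   probability measure on the plane, with X1 = fst and X2 = snd.  Bochner integrals of
   non-integrable functions are 0, hence has_bochner_integral: each moment exists and has the
   prescribed value. *)
definition ambiguity_set :: "real \<times> real \<times> real \<times> real \<times> real \<Rightarrow> (real \<times> real) measure set" where
  "ambiguity_set = (\<lambda>(m1, m2, m11, m22, m12).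
     {P. prob_space P \<and> sets P = sets borel \<and>
         (AE x in P. x \<in> {0..} \<times> {0..}) \<and>
         has_bochner_integral P (\<lambda>x. fst x) m1 \<and>
         has_bochner_integral P (\<lambda>x. snd x) m2 \<and>
         has_bochner_integral P (\<lambda>x. (fst x)\<^sup>2) m11 \<and>
         has_bochner_integral P (\<lambda>x. (snd x)\<^sup>2) m22 \<and>
         has_bochner_integral P (\<lambda>x. fst x * snd x) m12})"

(* The supremum is taken in the extended reals, so it is meaningful without a boundedness argument.
   For P in the ambiguity set the integrand is integrable, since its absolute value is bounded by
   |X1| + |X2| + |q|. *)
definition v_P :: "real \<Rightarrow> real \<times> real \<times> real \<times> real \<times> real \<Rightarrow> ereal" where
  "v_P q \<theta> = (SUP P\<in>ambiguity_set \<theta>. ereal (\<integral>x. pos_part (fst x + snd x - q) \<partial>P))"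

(* If a, b > 1 and (a - 1) (b - 1) >= (c - 1)^2, the radicands of Q_a and Q_b are nonnegative: e.g.
   that of Q_a is (q - (a - c) / (a - 1) * \<mu>2)^2
   + a * ((a - 1) * (b - 1) - (c - 1)^2) / (a - 1)^2 * \<mu>2^2.
   That of Q_c is E[(X1 + X2 - q)^2]. *)
definition Q_a :: "real \<Rightarrow> real \<Rightarrow> real \<Rightarrow> real \<Rightarrow> real \<Rightarrow> real" where
  "Q_a a b c \<mu>2 q =
     sqrt (q\<^sup>2 - 2 * q * ((a - c) / (a - 1)) * \<mu>2 + (a * b - c\<^sup>2) / (a - 1) * \<mu>2\<^sup>2)"

definition Q_b :: "real \<Rightarrow> real \<Rightarrow> real \<Rightarrow> real \<Rightarrow> real \<Rightarrow> real" where
  "Q_b a b c \<mu>1 q =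
     sqrt (q\<^sup>2 - 2 * q * ((b - c) / (b - 1)) * \<mu>1 + (a * b - c\<^sup>2) / (b - 1) * \<mu>1\<^sup>2)"

definition Q_c :: "real \<Rightarrow> real \<Rightarrow> real \<Rightarrow> real \<Rightarrow> real \<Rightarrow> real \<Rightarrow> real" where
  "Q_c a b c \<mu>1 \<mu>2 q =
     sqrt (q\<^sup>2 - 2 * q * (\<mu>1 + \<mu>2) + a * \<mu>1\<^sup>2 + b * \<mu>2\<^sup>2 + 2 * c * \<mu>1 * \<mu>2)"

definition \<zeta>_a :: "real \<Rightarrow> real \<Rightarrow> real \<Rightarrow> real \<Rightarrow> real \<Rightarrow> real" where
  "\<zeta>_a a c \<mu>1 \<mu>2 q = a * \<mu>1 + c * \<mu>2 - q"

definition \<zeta>_b :: "real \<Rightarrow> real \<Rightarrow> real \<Rightarrow> real \<Rightarrow> real \<Rightarrow> real" where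
  "\<zeta>_b b c \<mu>1 \<mu>2 q = c * \<mu>1 + b * \<mu>2 - q"

end

theory Submission
  imports Defs
begin

text \<open>Weak duality bounds the expected payoff by the expectation of any quadratic function that
  dominates \<open>(x + y - q)\<^sub>+\<close> on the quadrant, and that expectation depends only on the given
  moments. In each regime the majorant is, up to a multiple of \<open>x + y - q\<close>, the square of an affine
  function \<open>L\<close>, and complementary slackness locates the mass of an optimal law: on the zero set of
  \<open>L\<close> and where the majorant touches the payoff on the other side of the threshold. Explicit laws
  with at most six atoms meet these constraints. The quantities \<open>Q_a\<close>, \<open>Q_b\<close> and \<open>Q_c\<close> are root mean
  squares: \<open>(1 - 1/b) Q_b\<^sup>2\<close> is the squared distance of \<open>X1 - q\<close> from the multiples of \<open>X2\<close> in
  \<open>L\<^sup>2\<close>. Hence \<open>(b - 1) Q_b\<^sup>2 = b Q_c\<^sup>2 - \<zeta>_b\<^sup>2\<close>, and the last regime is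
  \<open>Q_c > \<bar>\<zeta>_a\<bar>, \<bar>\<zeta>_b\<bar>\<close>: a law on the two lines \<open>x + y = q \<plusminus> Q_c\<close> then puts positive
  first moments on both.\<close>

section \<open>Integrals of quadratics and of the payoff\<close>

lemma ambiguity_set_iff:
  "P \<in> ambiguity_set (m1, m2, m11, m22, m12) \<longleftrightarrow>
     prob_space P \<and> sets P = sets borel \<and> (AE x in P. x \<in> {0..} \<times> {0..}) \<and>
     has_bochner_integral P fst m1 \<and> has_bochner_integral P snd m2 \<and>
     has_bochner_integral P (\<lambda>x. (fst x)\<^sup>2) m11 \<and>
     has_bochner_integral P (\<lambda>x. (snd x)\<^sup>2) m22 \<and>
     has_bochner_integral P (\<lambda>x. fst x * snd x) m12"
  by (simp add: ambiguity_set_def)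

lemma has_bochner_integral_quadratic:
  assumes P: "P \<in> ambiguity_set (m1, m2, m11, m22, m12)"
  shows "has_bochner_integral P
           (\<lambda>x. k0 + k1 * fst x + k2 * snd x + k11 * (fst x)\<^sup>2 + k22 * (snd x)\<^sup>2 + k12 * (fst x * snd x))
           (k0 + k1 * m1 + k2 * m2 + k11 * m11 + k22 * m22 + k12 * m12)"
proof -
  interpret prob_space P using P by (simp add: ambiguity_set_iff)
  have "has_bochner_integral P (\<lambda>x. k0) (k0::real)"
    by (simp add: has_bochner_integral_iff prob_space)
  then show ?thesis
    using P unfolding ambiguity_set_iff
    by (intro has_bochner_integral_add has_bochner_integral_mult_right) auto
qed

lemma borel_measurable_payoff:
  "(\<lambda>x::real \<times> real. pos_part (fst x + snd x - q)) \<in> borel_measurable borel"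
  unfolding pos_part_def by (intro borel_measurable_continuous_onI continuous_intros)

lemma borel_measurable_moments:
  "fst \<in> borel_measurable (borel :: (real \<times> real) measure)"
  "snd \<in> borel_measurable (borel :: (real \<times> real) measure)"
  "(\<lambda>x::real \<times> real. (fst x)\<^sup>2) \<in> borel_measurable borel"
  "(\<lambda>x::real \<times> real. (snd x)\<^sup>2) \<in> borel_measurable borel"
  "(\<lambda>x::real \<times> real. fst x * snd x) \<in> borel_measurable borel"
  by (intro borel_measurable_continuous_onI continuous_intros)+

lemma has_bochner_integral_excess:
  assumes "P \<in> ambiguity_set (m1, m2, m11, m22, m12)"
  shows "has_bochner_integral P (\<lambda>x. fst x + snd x - q) (m1 + m2 - q)"
  using has_bochner_integral_quadratic[OF assms, of "- q" 1 1 0 0 0] by (simp add: algebra_simps)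

lemma integrable_payoff:
  assumes P: "P \<in> ambiguity_set (m1, m2, m11, m22, m12)"
  shows "integrable P (\<lambda>x. pos_part (fst x + snd x - q))"
proof (rule Bochner_Integration.integrable_bound)
  show "integrable P (\<lambda>x. fst x + snd x - q)"
    using has_bochner_integral_excess[OF P] by (simp only: has_bochner_integral_iff)
  have "sets P = sets borel" using P by (simp add: ambiguity_set_iff)
  then show "(\<lambda>x. pos_part (fst x + snd x - q)) \<in> borel_measurable P"
    using borel_measurable_payoff measurable_cong_sets[OF _ refl] by blast
  show "AE x in P. norm (pos_part (fst x + snd x - q)) \<le> norm (fst x + snd x - q)"
    by (rule AE_I2) (simp add: pos_part_def)
qed

lemma payoff_le_quadratic:
  assumes P: "P \<in> ambiguity_set (m1, m2, m11, m22, m12)"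
    and le: "\<And>x y. x \<ge> 0 \<Longrightarrow> y \<ge> 0 \<Longrightarrow>
      pos_part (x + y - q) \<le> k0 + k1 * x + k2 * y + k11 * x\<^sup>2 + k22 * y\<^sup>2 + k12 * (x * y)"
  shows "(\<integral>x. pos_part (fst x + snd x - q) \<partial>P)
           \<le> k0 + k1 * m1 + k2 * m2 + k11 * m11 + k22 * m22 + k12 * m12"
proof -
  note Q = has_bochner_integral_quadratic[OF P, of k0 k1 k2 k11 k22 k12]
  have "AE x in P. x \<in> {0..} \<times> {0..}" using P by (simp add: ambiguity_set_iff)
  then have "AE x in P. pos_part (fst x + snd x - q) \<le>
      k0 + k1 * fst x + k2 * snd x + k11 * (fst x)\<^sup>2 + k22 * (snd x)\<^sup>2 + k12 * (fst x * snd x)"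
    by (rule eventually_mono) (rule le, auto)
  then have "(\<integral>x. pos_part (fst x + snd x - q) \<partial>P) \<le>
    (\<integral>x. k0 + k1 * fst x + k2 * snd x + k11 * (fst x)\<^sup>2 + k22 * (snd x)\<^sup>2 + k12 * (fst x * snd x) \<partial>P)"
    using integral_mono_AE[OF integrable_payoff[OF P]] Q unfolding has_bochner_integral_iff by blast
  then show ?thesis using Q by (simp add: has_bochner_integral_iff)
qed

text \<open>In the degenerate case \<open>Qb q = 0\<close> one of these Jensen-type bounds equals
  the claimed value, so any admissible law attains it.\<close>

lemma payoff_ge:
  assumes P: "P \<in> ambiguity_set (m1, m2, m11, m22, m12)"
  shows "0 \<le> (\<integral>x. pos_part (fst x + snd x - q) \<partial>P)"
    and "m1 + m2 - q \<le> (\<integral>x. pos_part (fst x + snd x - q) \<partial>P)"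
proof -
  show "0 \<le> (\<integral>x. pos_part (fst x + snd x - q) \<partial>P)"
    by (intro integral_nonneg_AE) (auto simp: pos_part_def)
  have "(\<integral>x. fst x + snd x - q \<partial>P) \<le> (\<integral>x. pos_part (fst x + snd x - q) \<partial>P)"
  proof (rule integral_mono)
    show "integrable P (\<lambda>x. fst x + snd x - q)"
      using has_bochner_integral_excess[OF P] by (simp only: has_bochner_integral_iff)
  qed (auto simp: pos_part_def intro: integrable_payoff[OF P, unfolded pos_part_def])
  then show "m1 + m2 - q \<le> (\<integral>x. pos_part (fst x + snd x - q) \<partial>P)"
    using has_bochner_integral_excess[OF P, of q] by (simp only: has_bochner_integral_iff)
qed

section \<open>Discrete laws and the value of the supremum\<close>

lemma finite_law:
  fixes w x y :: "nat \<Rightarrow> real"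
  assumes w: "\<And>i. i < n \<Longrightarrow> w i \<ge> 0" and w1: "(\<Sum>i<n. w i) = 1"
    and x: "\<And>i. i < n \<Longrightarrow> x i \<ge> 0" and y: "\<And>i. i < n \<Longrightarrow> y i \<ge> 0"
    and m: "(\<Sum>i<n. w i * x i) = m1" "(\<Sum>i<n. w i * y i) = m2"
      "(\<Sum>i<n. w i * (x i)\<^sup>2) = m11" "(\<Sum>i<n. w i * (y i)\<^sup>2) = m22"
      "(\<Sum>i<n. w i * (x i * y i)) = m12"
  shows "\<exists>P\<in>ambiguity_set (m1, m2, m11, m22, m12).
           (\<integral>z. pos_part (fst z + snd z - q) \<partial>P) = (\<Sum>i<n. w i * pos_part (x i + y i - q))"
proof -
  define v where "v i = (if i < n then w i else 0)" for i
  define p where "p = embed_pmf v"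
  have v0: "v i \<ge> 0" for i by (simp add: v_def w)
  have "(\<integral>\<^sup>+i. ennreal (v i) \<partial>count_space UNIV) = (\<Sum>i<n. ennreal (v i))"
    by (rule nn_integral_count_space'[of "{..<n}"]) (auto simp: v_def)
  also have "\<dots> = ennreal (\<Sum>i<n. v i)" by (rule sum_ennreal) (simp add: v0)
  also have "(\<Sum>i<n. v i) = 1" using w1 by (simp add: v_def)
  finally have v1: "(\<integral>\<^sup>+i. ennreal (v i) \<partial>count_space UNIV) = 1" by simp
  have pmf: "pmf p i = v i" for i unfolding p_def by (rule pmf_embed_pmf[OF v0 v1])
  have sup: "set_pmf p \<subseteq> {..<n}" by (auto simp: set_pmf_iff pmf v_def split: if_splits)
  \<comment> \<open>Pushing forward from the indices allows coinciding atoms and zero weights, so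
    degenerate parameters need no case split.\<close>
  define P :: "(real \<times> real) measure" where "P = distr (measure_pmf p) borel (\<lambda>i. (x i, y i))"
  have int: "has_bochner_integral P f (\<Sum>i<n. w i * f (x i, y i))"
    if [measurable]: "f \<in> borel_measurable borel" for f :: "real \<times> real \<Rightarrow> real"
  proof -
    have "integrable (measure_pmf p) (\<lambda>i. f (x i, y i))"
      by (rule integrable_measure_pmf_finite) (rule finite_subset[OF sup], simp)
    moreover have "(\<integral>i. f (x i, y i) \<partial>measure_pmf p) = (\<Sum>i<n. w i * f (x i, y i))"
      using sup by (subst integral_measure_pmf_real[of "{..<n}"])
        (auto simp: pmf v_def mult.commute intro!: sum.cong)
    ultimately have "has_bochner_integral (measure_pmf p) (\<lambda>i. f (x i, y i)) (\<Sum>i<n. w i * f (x i, y i))"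
      by (simp add: has_bochner_integral_iff)
    then show ?thesis unfolding P_def by (intro has_bochner_integral_distr) simp_all
  qed
  have "prob_space P" unfolding P_def
    by (intro prob_space.prob_space_distr measure_pmf.prob_space_axioms) simp
  moreover have "sets P = sets borel" by (simp add: P_def)
  moreover have "AE z in P. z \<in> {0..} \<times> {0..}"
  proof -
    have "closed ({0..} \<times> {0..} :: (real \<times> real) set)" by (intro closed_Times closed_atLeast)
    then show ?thesis unfolding P_def using sup
      by (subst AE_distr_iff) (auto simp: AE_measure_pmf_iff x y)
  qed
  ultimately have "P \<in> ambiguity_set (m1, m2, m11, m22, m12)"
    unfolding ambiguity_set_iff
    using borel_measurable_moments[THEN int] by (simp only: fst_conv snd_conv m simp_thms)
  moreover have "(\<integral>z. pos_part (fst z + snd z - q) \<partial>P) = (\<Sum>i<n. w i * pos_part (x i + y i - q))"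
    using int[OF borel_measurable_payoff] by (simp only: has_bochner_integral_iff fst_conv snd_conv)
  ultimately show ?thesis by blast
qed

lemma v_P_eqI:
  assumes "\<And>P. P \<in> ambiguity_set \<theta> \<Longrightarrow> (\<integral>z. pos_part (fst z + snd z - q) \<partial>P) \<le> V"
    and "\<exists>P\<in>ambiguity_set \<theta>. (\<integral>z. pos_part (fst z + snd z - q) \<partial>P) \<ge> V"
  shows "v_P q \<theta> = ereal V"
  unfolding v_P_def
proof (rule antisym)
  show "(SUP P\<in>ambiguity_set \<theta>. ereal (\<integral>z. pos_part (fst z + snd z - q) \<partial>P)) \<le> ereal V"
    by (rule SUP_least) (simp add: assms(1))
  show "ereal V \<le> (SUP P\<in>ambiguity_set \<theta>. ereal (\<integral>z. pos_part (fst z + snd z - q) \<partial>P))"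
    using assms(2) by (meson SUP_upper2 ereal_less_eq(3))
qed

section \<open>Exchanging the two coordinates\<close>

lemma ambiguity_set_swap:
  assumes P: "P \<in> ambiguity_set (m1, m2, m11, m22, m12)"
  shows "\<exists>P'\<in>ambiguity_set (m2, m1, m22, m11, m12).
     (\<integral>z. pos_part (fst z + snd z - q) \<partial>P') = (\<integral>z. pos_part (fst z + snd z - q) \<partial>P)"
proof -
  define P' :: "(real \<times> real) measure" where "P' = distr P borel (\<lambda>z. (snd z, fst z))"
  have sets: "sets P = sets borel" using P by (simp add: ambiguity_set_iff)
  have "(\<lambda>z::real\<times>real. (snd z, fst z)) \<in> borel \<rightarrow>\<^sub>M borel" by (simp add: borel_prod[symmetric])
  then have m [measurable]: "(\<lambda>z. (snd z, fst z)) \<in> P \<rightarrow>\<^sub>M (borel :: (real \<times> real) measure)"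
    using measurable_cong_sets[OF sets refl] by blast
  have int: "has_bochner_integral P (\<lambda>z. f (snd z, fst z)) c \<Longrightarrow> has_bochner_integral P' f c"
    if "f \<in> borel_measurable borel" for f :: "real \<times> real \<Rightarrow> real" and c
    unfolding P'_def by (rule has_bochner_integral_distr[OF that m])
  have "prob_space P'" unfolding P'_def
    by (intro prob_space.prob_space_distr m) (use P in \<open>simp add: ambiguity_set_iff\<close>)
  moreover have "sets P' = sets borel" by (simp add: P'_def)
  moreover have "AE z in P'. z \<in> {0..} \<times> {0..}"
  proof -
    have "closed ({0..} \<times> {0..} :: (real \<times> real) set)" by (intro closed_Times closed_atLeast)
    then show ?thesis unfolding P'_def using P
      by (subst AE_distr_iff) (auto simp: ambiguity_set_iff m elim!: eventually_mono)
  qed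
  ultimately have "P' \<in> ambiguity_set (m2, m1, m22, m11, m12)"
    using P borel_measurable_moments[THEN int] unfolding ambiguity_set_iff
    by (simp only: fst_conv snd_conv mult.commute simp_thms)
  moreover have "(\<integral>z. pos_part (fst z + snd z - q) \<partial>P') = (\<integral>z. pos_part (fst z + snd z - q) \<partial>P)"
    unfolding P'_def by (subst integral_distr[OF m borel_measurable_payoff]) (simp only: fst_conv snd_conv add.commute)
  ultimately show ?thesis by blast
qed

lemma v_P_swap: "v_P q (m1, m2, m11, m22, m12) = v_P q (m2, m1, m22, m11, m12)"
proof -
  have "v_P q (m1, m2, m11, m22, m12) \<le> v_P q (m2, m1, m22, m11, m12)" for m1 m2 m11 m22 m12
    unfolding v_P_def
  proof (rule SUP_mono)
    fix P assume "P \<in> ambiguity_set (m1, m2, m11, m22, m12)"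
    then obtain P' where "P' \<in> ambiguity_set (m2, m1, m22, m11, m12)"
      "(\<integral>z. pos_part (fst z + snd z - q) \<partial>P') = (\<integral>z. pos_part (fst z + snd z - q) \<partial>P)"
      using ambiguity_set_swap by blast
    then show "\<exists>P'\<in>ambiguity_set (m2, m1, m22, m11, m12).
        ereal (\<integral>z. pos_part (fst z + snd z - q) \<partial>P) \<le> ereal (\<integral>z. pos_part (fst z + snd z - q) \<partial>P')"
      by (intro bexI[of _ P']) simp_all
  qed
  then show ?thesis by (blast intro: antisym)
qed

section \<open>Majorants built from one square\<close>

text \<open>The shape shared by all majorants below: a tilt \<open>e\<close>, which is 0 or 1, a
  constant \<open>d\<close>, nonzero only in limiting arguments, and a weighted square of an affine
  function, whose second moment is kept as one block.\<close>

lemma payoff_le_square: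
  assumes P: "P \<in> ambiguity_set (m1, m2, m11, m22, m12)"
    and le: "\<And>x y. x \<ge> 0 \<Longrightarrow> y \<ge> 0 \<Longrightarrow>
      pos_part (x + y - q) \<le> e * (x + y - q) + d + f * (s * x + t * y - r)\<^sup>2"
  shows "(\<integral>x. pos_part (fst x + snd x - q) \<partial>P) \<le> e * (m1 + m2 - q) + d
           + f * (s\<^sup>2 * m11 + t\<^sup>2 * m22 + r\<^sup>2 + 2 * s * t * m12 - 2 * r * s * m1 - 2 * r * t * m2)"
proof -
  have "(\<integral>x. pos_part (fst x + snd x - q) \<partial>P) \<le>
     (d - e * q + f * r\<^sup>2) + (e - 2 * f * r * s) * m1 + (e - 2 * f * r * t) * m2
       + f * s\<^sup>2 * m11 + f * t\<^sup>2 * m22 + 2 * f * s * t * m12"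
  proof (rule payoff_le_quadratic[OF P])
    fix x y :: real assume "x \<ge> 0" "y \<ge> 0"
    from le[OF this] show "pos_part (x + y - q) \<le> (d - e * q + f * r\<^sup>2) + (e - 2 * f * r * s) * x
       + (e - 2 * f * r * t) * y + f * s\<^sup>2 * x\<^sup>2 + f * t\<^sup>2 * y\<^sup>2 + 2 * f * s * t * (x * y)"
      by (simp add: power2_eq_square algebra_simps)
  qed
  then show ?thesis by (simp add: algebra_simps)
qed

text \<open>The parabola vanishes at \<open>y = - Q\<close> and is tangent to the identity at
  \<open>y = Q\<close>: its gap to \<open>y\<close> is \<open>(y - Q)^2 / (4 * Q)\<close>. The slack
  between \<open>t\<close> and \<open>y\<close> leaves room to change the slope in the second
  coordinate.\<close>

lemma pos_part_le_square:
  assumes "Q > 0" "t \<le> y"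
  shows "pos_part t \<le> (y + Q)\<^sup>2 / (4 * Q)"
proof -
  have "y * (4 * Q) \<le> (y + Q)\<^sup>2" using zero_le_power2[of "y - Q"]
    by (simp add: power2_eq_square algebra_simps)
  then have "y \<le> (y + Q)\<^sup>2 / (4 * Q)" using assms(1) by (simp add: pos_le_divide_eq)
  moreover have "0 \<le> (y + Q)\<^sup>2 / (4 * Q)" using assms(1) by simp
  ultimately show ?thesis using assms(2) by (simp add: pos_part_def)
qed

text \<open>The gap to \<open>y\<close> is \<open>(y - 2 * \<epsilon>)^2 / (4 * \<epsilon>)\<close>.
  If \<open>y\<close> has zero second moment, only \<epsilon> survives integration.\<close>

lemma pos_part_le_eps_square:
  assumes "\<epsilon> > 0" "t \<le> y"
  shows "pos_part t \<le> \<epsilon> + y\<^sup>2 / (4 * \<epsilon>)"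
proof -
  have "(y - \<epsilon>) * (4 * \<epsilon>) \<le> y\<^sup>2" using zero_le_power2[of "y - 2 * \<epsilon>"]
    by (simp add: power2_eq_square algebra_simps)
  then have "y - \<epsilon> \<le> y\<^sup>2 / (4 * \<epsilon>)" using assms(1) by (simp add: pos_le_divide_eq)
  moreover have "0 \<le> y\<^sup>2 / (4 * \<epsilon>)" using assms(1) by simp
  ultimately show ?thesis using assms unfolding pos_part_def by linarith
qed

lemma bex_eq_imp_bex_le: "\<exists>x\<in>A. f x = (V :: real) \<Longrightarrow> \<exists>x\<in>A. V \<le> f x"
  by auto

text \<open>Put-call parity: adding \<open>t\<close> to a majorant for the opposite side gives one
  for the payoff.\<close>

lemma pos_part_reflect: "pos_part t = t + pos_part (- t)"
  by (simp add: pos_part_def)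

section \<open>Laws on two parallel lines\<close>

text \<open>Interpolates between two laws on the lines \<open>x + y = h\<close> and \<open>x + y = l\<close> of masses \<open>p\<close> and
  \<open>r\<close>: all mass at the conditional means, which minimises the second moments, and all mass at the
  end points of the segments, which makes the cross moment vanish.\<close>

lemma two_line_law:
  fixes p r h l x y u v :: real
  assumes pos: "p > 0" "r > 0" "h > 0" "l > 0" "x \<ge> 0" "y \<ge> 0" "u \<ge> 0" "v \<ge> 0"
    and mass: "p + r = 1" and hp: "x + y = h * p" and lr: "u + v = l * r"
    and m1: "x + u = m1" and m2: "y + v = m2"
    and sec: "h * x + l * u = m11 + m12" "h * y + l * v = m12 + m22"
    and lower: "y\<^sup>2 / p + v\<^sup>2 / r \<le> m22" and upper: "m12 \<ge> 0"
    and q: "l \<le> q" "q \<le> h"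
  shows "\<exists>P\<in>ambiguity_set (m1, m2, m11, m22, m12).
           (\<integral>z. pos_part (fst z + snd z - q) \<partial>P) = p * (h - q)"
proof -
  \<comment> \<open>\<open>G\<close> and \<open>T\<close> are the second moments of the second
    coordinate under the two extreme laws; \<open>k\<close> is the mixing weight that produces
    \<open>m22\<close>.\<close>
  define G where "G = y\<^sup>2 / p + v\<^sup>2 / r"
  define T where "T = m12 + m22"
  obtain k where k: "0 \<le> k" "k \<le> 1" "m22 = (1 - k) * G + k * T"
  proof (cases "T = G")
    case True
    then show ?thesis using that[of 0] lower upper by (simp add: G_def T_def)
  next
    case False
    have GT: "G \<le> m22" "m22 \<le> T" using lower upper by (simp_all add: G_def T_def)
    define k where "k = (m22 - G) / (T - G)"
    have "k * (T - G) = m22 - G" using False by (simp add: k_def)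
    moreover have "0 \<le> k" "k \<le> 1" using False GT by (auto simp: k_def divide_simps)
    ultimately show ?thesis by (intro that[of k]) (auto simp: algebra_simps)
  qed
  have yx: "x * y / p = h * y - y\<^sup>2 / p" "u * v / r = l * v - v\<^sup>2 / r"
    and xx: "x\<^sup>2 / p = h * x - x * y / p" "u\<^sup>2 / r = l * u - u * v / r"
  proof -
    have x: "x = h * p - y" and u: "u = l * r - v" using hp lr by simp_all
    show "x * y / p = h * y - y\<^sup>2 / p" "u * v / r = l * v - v\<^sup>2 / r"
      "x\<^sup>2 / p = h * x - x * y / p" "u\<^sup>2 / r = l * u - u * v / r"
      unfolding x u using pos(1,2) by (simp_all add: field_simps power2_eq_square)
  qed
  \<comment> \<open>Both extreme laws give the same first moments and, by \<open>sec\<close>, the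
    same moments of each coordinate times the sum. Hence matching \<open>m22\<close> also matches
    \<open>m12\<close> and then \<open>m11\<close>.\<close>
  have cross: "(1 - k) * (x * y / p + u * v / r) = m12"
  proof -
    have "x * y / p + u * v / r = T - G" unfolding yx using sec by (simp add: G_def T_def)
    moreover have "(1 - k) * (T - G) = T - m22" unfolding k(3) by (simp add: algebra_simps)
    ultimately show ?thesis by (simp add: T_def)
  qed
  \<comment> \<open>Two conditional means, then the four end points. An end point such as
    \<open>(h, 0)\<close> gets mass \<open>x / h\<close> so that the first moments on its line are
    kept.\<close>
  define w where "w = (\<lambda>i::nat. [(1 - k) * p, (1 - k) * r, k * x / h, k * y / h, k * u / l, k * v / l] ! i)"
  define X where "X = (\<lambda>i::nat. [x / p, u / r, h, 0, l, 0] ! i)"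
  define Y where "Y = (\<lambda>i::nat. [y / p, v / r, 0, h, 0, l] ! i)"
  have sum: "(\<Sum>i<6. f i) = f 0 + f 1 + f 2 + f 3 + f 4 + f 5" for f :: "nat \<Rightarrow> real"
    by (simp add: eval_nat_numeral)
  have lt: "i < 6 \<longleftrightarrow> i = 0 \<or> i = 1 \<or> i = 2 \<or> i = 3 \<or> i = 4 \<or> i = 5" for i :: nat by auto
  have "\<exists>P\<in>ambiguity_set (m1, m2, m11, m22, m12).
      (\<integral>z. pos_part (fst z + snd z - q) \<partial>P) = (\<Sum>i<6. w i * pos_part (X i + Y i - q))"
  proof (rule finite_law)
    show "w i \<ge> 0" "X i \<ge> 0" "Y i \<ge> 0" if "i < 6" for i
      using that pos k(1,2) unfolding lt by (auto simp: w_def X_def Y_def)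
    have "(\<Sum>i<6. w i) = (1 - k) * (p + r) + k * ((x + y) / h + (u + v) / l)"
      unfolding sum by (simp add: w_def algebra_simps add_divide_distrib)
    then show "(\<Sum>i<6. w i) = 1" using pos mass by (simp add: hp lr)
    show "(\<Sum>i<6. w i * X i) = m1" "(\<Sum>i<6. w i * Y i) = m2"
      unfolding sum using pos by (simp_all add: w_def X_def Y_def m1[symmetric] m2[symmetric] algebra_simps)
    have "(\<Sum>i<6. w i * (X i * Y i)) = (1 - k) * (x * y / p + u * v / r)"
      unfolding sum using pos by (simp add: w_def X_def Y_def field_simps)
    then show "(\<Sum>i<6. w i * (X i * Y i)) = m12" using cross by simp
    have "(\<Sum>i<6. w i * (Y i)\<^sup>2) = (1 - k) * G + k * (h * y + l * v)"
      unfolding sum G_def using pos by (simp add: w_def X_def Y_def field_simps power2_eq_square)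
    then show "(\<Sum>i<6. w i * (Y i)\<^sup>2) = m22" 
      unfolding sec(2) T_def[symmetric] k(3)[symmetric] .
    have "(\<Sum>i<6. w i * (X i)\<^sup>2) = (1 - k) * (x\<^sup>2 / p + u\<^sup>2 / r) + k * (h * x + l * u)"
      unfolding sum using pos by (simp add: w_def X_def Y_def field_simps power2_eq_square)
    also have "\<dots> = (h * x + l * u) - (1 - k) * (x * y / p + u * v / r)"
      unfolding xx by (simp add: algebra_simps)
    finally show "(\<Sum>i<6. w i * (X i)\<^sup>2) = m11" using cross sec by simp
  qed
  also have "(\<Sum>i<6. w i * pos_part (X i + Y i - q)) = p * (h - q)"
  proof -
    have "x / p + y / p = h" "u / r + v / r = l"
      using pos hp lr by (simp_all add: add_divide_distrib[symmetric])
    then have "(\<Sum>i<6. w i * pos_part (X i + Y i - q)) = ((1 - k) * p + k * ((x + y) / h)) * (h - q)"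
      unfolding sum using q by (simp add: w_def X_def Y_def pos_part_def algebra_simps add_divide_distrib)
    then show ?thesis using pos by (simp add: hp algebra_simps)
  qed
  finally show ?thesis .
qed

section \<open>Moment data, residuals and laws with one atom off the first axis\<close>

locale moment_problem =
  fixes \<mu>1 \<mu>2 a b c :: real
  assumes mu: "\<mu>1 > 0" "\<mu>2 > 0" and ab: "a > 1" "b > 1" and c: "c \<ge> 0"
    and psd: "(a - 1) * (b - 1) \<ge> (c - 1)\<^sup>2"
    and nonempty: "ambiguity_set (\<mu>1, \<mu>2, a * \<mu>1\<^sup>2, b * \<mu>2\<^sup>2, c * \<mu>1 * \<mu>2) \<noteq> {}"
begin

abbreviation "\<theta> \<equiv> (\<mu>1, \<mu>2, a * \<mu>1\<^sup>2, b * \<mu>2\<^sup>2, c * \<mu>1 * \<mu>2)"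
abbreviation "Qb \<equiv> Q_b a b c \<mu>1"
abbreviation "\<zeta>b \<equiv> \<zeta>_b b c \<mu>1 \<mu>2"
abbreviation "m \<equiv> (b - c) / (b - 1) * \<mu>1"
abbreviation "R \<equiv> (a * b - c\<^sup>2) / (b - 1) * \<mu>1\<^sup>2"

text \<open>\<open>m\<close> and \<open>R\<close> play the part of a first and a second moment;
  their variance is a positive multiple of the slack in \<open>psd\<close>.\<close>

lemma m_sq_le: "m\<^sup>2 \<le> R"
proof -
  have "R - m\<^sup>2 = b * ((a - 1) * (b - 1) - (c - 1)\<^sup>2) * (\<mu>1 / (b - 1))\<^sup>2"
    using ab by (simp add: divide_simps) (simp add: power2_eq_square algebra_simps)
  also have "\<dots> \<ge> 0" using ab psd by simp
  finally show ?thesis by simp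
qed

lemma Qb_sq: "(Qb q)\<^sup>2 = q\<^sup>2 - 2 * q * m + R"
proof -
  have "q\<^sup>2 - 2 * q * m + R = (q - m)\<^sup>2 + (R - m\<^sup>2)" by (simp add: power2_diff)
  also have "\<dots> \<ge> 0" using m_sq_le by simp
  finally have "0 \<le> q\<^sup>2 - 2 * q * m + R" .
  then show ?thesis by (simp add: Q_b_def mult.assoc)
qed

lemma Qb_nonneg: "Qb q \<ge> 0"
  using Qb_sq[of q] zero_le_power2[of "Qb q"] by (simp add: Q_b_def mult.assoc)

text \<open>Completing the square gives \<open>(Qb q)^2 = (q - m)^2 + (R - m^2)\<close>. The bound
  makes the two axis weights in \<open>axis_law_Qb\<close> nonnegative.\<close>

lemma Qb_ge: "\<bar>q - m\<bar> \<le> Qb q"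
proof -
  have "(q - m)\<^sup>2 \<le> (Qb q)\<^sup>2" unfolding Qb_sq using m_sq_le by (simp add: power2_diff)
  then show ?thesis using Qb_nonneg abs_le_square_iff[of "q - m" "Qb q"] by simp
qed

text \<open>The choice of \<open>k\<close> makes \<open>X1 + k X2 - r\<close> orthogonal to \<open>X2\<close>. The left-hand side has the shape
  in which \<open>payoff_le_square\<close> produces it.\<close>

lemma residual_second_moment:
  assumes "k = (r - c * \<mu>1) / (b * \<mu>2)"
  shows "1\<^sup>2 * (a * \<mu>1\<^sup>2) + k\<^sup>2 * (b * \<mu>2\<^sup>2) + r\<^sup>2 + 2 * 1 * k * (c * \<mu>1 * \<mu>2)
           - 2 * r * 1 * \<mu>1 - 2 * r * k * \<mu>2 = (b - 1) / b * (r\<^sup>2 - 2 * r * m + R)"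
proof -
  have k: "r = k * b * \<mu>2 + c * \<mu>1" using assms ab mu by simp
  have "(b - 1) / b * (r\<^sup>2 - 2 * r * M + N) = ((b - 1) * r\<^sup>2 - 2 * r * ((b - 1) * M) + (b - 1) * N) / b" for M N
    using ab by (simp add: field_simps)
  then have "(b - 1) / b * (r\<^sup>2 - 2 * r * m + R) = ((b - 1) * r\<^sup>2 - 2 * r * ((b - 1) * m) + (b - 1) * R) / b" .
  also have "(b - 1) * m = (b - c) * \<mu>1" using ab by simp
  also have "(b - 1) * R = (a * b - c\<^sup>2) * \<mu>1\<^sup>2" using ab by simp
  also have "((b - 1) * r\<^sup>2 - 2 * r * ((b - c) * \<mu>1) + (a * b - c\<^sup>2) * \<mu>1\<^sup>2) / b    = a * \<mu>1\<^sup>2 + r\<^sup>2 - 2 * r * \<mu>1 - (r - c * \<mu>1)\<^sup>2 / b"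
    using ab by (simp add: field_simps power2_eq_square)
  also have "(r - c * \<mu>1)\<^sup>2 / b = k\<^sup>2 * b * \<mu>2\<^sup>2"
    unfolding k using ab by (simp add: field_simps power2_eq_square)
  also have "a * \<mu>1\<^sup>2 + r\<^sup>2 - 2 * r * \<mu>1 - k\<^sup>2 * b * \<mu>2\<^sup>2 =
      1\<^sup>2 * (a * \<mu>1\<^sup>2) + k\<^sup>2 * (b * \<mu>2\<^sup>2) + r\<^sup>2 + 2 * 1 * k * (c * \<mu>1 * \<mu>2)
           - 2 * r * 1 * \<mu>1 - 2 * r * k * \<mu>2"
    unfolding k by (simp add: algebra_simps power2_eq_square)
  finally show ?thesis by simp
qed

text \<open>If all mass off the first axis sits at one atom, the moments involving \<open>X2\<close> force that atom to
  be \<open>(c \<mu>1, b \<mu>2)\<close> with mass \<open>1 / b\<close>. The rest, normalised, has first two moments \<open>m\<close> and \<open>R\<close>.\<close>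

lemma axis_law:
  assumes p: "p1 \<ge> 0" "p2 \<ge> 0" and x: "x1 \<ge> 0" "x2 \<ge> 0"
    and mass: "p1 + p2 = (b - 1) / b" and m1: "p1 * x1 + p2 * x2 = (b - 1) / b * m"
    and m11: "p1 * x1\<^sup>2 + p2 * x2\<^sup>2 = (b - 1) / b * R"
  shows "\<exists>P\<in>ambiguity_set \<theta>. (\<integral>z. pos_part (fst z + snd z - q) \<partial>P) =
           pos_part (\<zeta>b q) / b + p1 * pos_part (x1 - q) + p2 * pos_part (x2 - q)"
proof -
  define w where "w = (\<lambda>i::nat. [1 / b, p1, p2] ! i)"
  define X where "X = (\<lambda>i::nat. [c * \<mu>1, x1, x2] ! i)"
  define Y where "Y = (\<lambda>i::nat. [b * \<mu>2, 0, 0] ! i)"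
  have sum: "(\<Sum>i<3. f i) = f 0 + f 1 + f 2" for f :: "nat \<Rightarrow> real"
    by (simp add: eval_nat_numeral)
  have lt: "i < 3 \<longleftrightarrow> i = 0 \<or> i = 1 \<or> i = 2" for i :: nat by auto
  have "\<exists>P\<in>ambiguity_set \<theta>.
      (\<integral>z. pos_part (fst z + snd z - q) \<partial>P) = (\<Sum>i<3. w i * pos_part (X i + Y i - q))"
  proof (rule finite_law)
    show "w i \<ge> 0" "X i \<ge> 0" "Y i \<ge> 0" if "i < 3" for i
      using that p x c mu ab unfolding lt by (auto simp: w_def X_def Y_def)
    have "(\<Sum>i<3. w i) = 1 / b + (b - 1) / b"
      unfolding sum mass[symmetric] by (simp add: w_def)
    then show "(\<Sum>i<3. w i) = 1" using ab by (simp add: field_simps)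
    have "(\<Sum>i<3. w i * X i) = c * \<mu>1 / b + (b - 1) / b * m"
      unfolding sum m1[symmetric] by (simp add: w_def X_def)
    also have "\<dots> = c * \<mu>1 / b + (b - c) * \<mu>1 / b" using ab by simp
    also have "\<dots> = \<mu>1" using ab by (simp add: field_simps)
    finally show "(\<Sum>i<3. w i * X i) = \<mu>1" .
    have "(\<Sum>i<3. w i * (X i)\<^sup>2) = (c * \<mu>1)\<^sup>2 / b + (b - 1) / b * R"
      unfolding sum m11[symmetric] by (simp add: w_def X_def)
    also have "\<dots> = (c * \<mu>1)\<^sup>2 / b + (a * b - c\<^sup>2) * \<mu>1\<^sup>2 / b" using ab by simp
    also have "\<dots> = a * \<mu>1\<^sup>2" using ab by (simp add: field_simps power2_eq_square)
    finally show "(\<Sum>i<3. w i * (X i)\<^sup>2) = a * \<mu>1\<^sup>2" .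
    show "(\<Sum>i<3. w i * Y i) = \<mu>2" "(\<Sum>i<3. w i * (Y i)\<^sup>2) = b * \<mu>2\<^sup>2"
      "(\<Sum>i<3. w i * (X i * Y i)) = c * \<mu>1 * \<mu>2"
      unfolding sum using ab by (simp_all add: w_def X_def Y_def power2_eq_square)
  qed
  then show ?thesis unfolding sum by (simp add: w_def X_def Y_def \<zeta>_b_def add.assoc)
qed

text \<open>A variable with moments \<open>m\<close> and \<open>R\<close> has mean square distance
  \<open>(Qb q)^2\<close> from \<open>q\<close>, so two atoms at \<open>q - Qb q\<close> and
  \<open>q + Qb q\<close> can carry it; \<open>Qb q \<le> q\<close> keeps the left one in the
  quadrant. The sign of \<open>\<zeta>b q\<close> decides whether the atom off the axis
  pays.\<close>

lemma axis_law_Qb: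
  assumes Q: "0 < Qb q" "Qb q \<le> q"
  shows "\<exists>P\<in>ambiguity_set \<theta>. (\<integral>z. pos_part (fst z + snd z - q) \<partial>P) =
           pos_part (\<zeta>b q) / b + (b - 1) / (2 * b) * (m - (q - Qb q))"
proof -
  define Q where "Q = Qb q"
  \<comment> \<open>The normalised weights \<open>(1 + (m - q) / Q) / 2\<close> and
    \<open>(1 - (m - q) / Q) / 2\<close> give mean \<open>m\<close>.\<close>
  define p1 where "p1 = (b - 1) / b * ((Q + (m - q)) / (2 * Q))"
  define p2 where "p2 = (b - 1) / b * ((Q - (m - q)) / (2 * Q))"
  have Q0: "Q > 0" "Q \<le> q" using Q by (simp_all add: Q_def)
  have sq: "R = Q\<^sup>2 - q\<^sup>2 + 2 * q * m" using Qb_sq[of q] by (simp add: Q_def)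
  have ge: "\<bar>q - m\<bar> \<le> Q" using Qb_ge by (simp add: Q_def)
  have half: "(Q + e) / (2 * Q) + (Q - e) / (2 * Q) = 1" "((Q + e) / (2 * Q)) * Q - ((Q - e) / (2 * Q)) * Q = e" for e
    using Q0 by (simp_all add: field_simps)
  have "\<exists>P\<in>ambiguity_set \<theta>. (\<integral>z. pos_part (fst z + snd z - q) \<partial>P) =
           pos_part (\<zeta>b q) / b + p1 * pos_part (q + Q - q) + p2 * pos_part (q - Q - q)"
  proof (rule axis_law)
    show "p1 \<ge> 0" "p2 \<ge> 0" unfolding p1_def p2_def using ab Q0 ge
      by (auto intro!: mult_nonneg_nonneg divide_nonneg_nonneg)
    show "q + Q \<ge> 0" "q - Q \<ge> 0" using Q0 by auto
    show mass: "p1 + p2 = (b - 1) / b"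
      unfolding p1_def p2_def using half(1)[of "m - q"] by (metis distrib_left mult.right_neutral)
    have dif: "(p1 - p2) * Q = (b - 1) / b * (m - q)"
      unfolding p1_def p2_def using half(2)[of "m - q"] by (metis left_diff_distrib right_diff_distrib mult.assoc)
    have "p1 * (q + Q) + p2 * (q - Q) = (p1 + p2) * q + (p1 - p2) * Q" by (simp add: algebra_simps)
    also have "\<dots> = (b - 1) / b * m" unfolding mass dif by (simp add: algebra_simps)
    finally show "p1 * (q + Q) + p2 * (q - Q) = (b - 1) / b * m" .
    have "p1 * (q + Q)\<^sup>2 + p2 * (q - Q)\<^sup>2 = (p1 + p2) * (q\<^sup>2 + Q\<^sup>2) + 2 * q * ((p1 - p2) * Q)"
      by (simp add: algebra_simps power2_eq_square)
    also have "\<dots> = (b - 1) / b * R" unfolding mass dif sq by (simp add: algebra_simps power2_eq_square)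
    finally show "p1 * (q + Q)\<^sup>2 + p2 * (q - Q)\<^sup>2 = (b - 1) / b * R" .
  qed
  moreover have "p1 * Q = (b - 1) / (2 * b) * (m - (q - Q))"
    unfolding p1_def using Q0 ab by (simp add: field_simps)
  ultimately show ?thesis using Q0 by (simp add: pos_part_def Q_def)
qed

section \<open>The regimes with \<open>Qb q < q\<close>\<close>

lemma Qb_zero:
  assumes "Qb q = 0" shows "m = q" "(b - 1) / b * (q\<^sup>2 - 2 * q * m + R) = 0"
  using Qb_ge[of q] Qb_sq[of q] assms by simp_all

text \<open>For \<open>Q_b = 0\<close> the optimal majorant degenerates (division by zero), hence the separate
  limiting argument in this and the next proof.\<close>

lemma v_P_low:
  assumes q: "q > 0" and Q: "Qb q < q" "Qb q \<le> - \<zeta>b q"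
  shows "v_P q \<theta> = ereal ((b - 1) / (2 * b) * (m - (q - Qb q)))"
proof (rule v_P_eqI)
  \<comment> \<open>With this slope the affine function vanishes at
    \<open>(c * \<mu>1, b * \<mu>2)\<close> and at \<open>(q - Qb q, 0)\<close>. The regime
    condition says exactly \<open>k \<ge> 1\<close>, so \<open>x + k * y - q\<close> dominates
    \<open>x + y - q\<close> on the quadrant.\<close>
  define k where "k = (q - Qb q - c * \<mu>1) / (b * \<mu>2)"
  have k: "k \<ge> 1" using Q(2) mu ab by (simp add: k_def \<zeta>_b_def field_simps)
  note res = residual_second_moment[OF k_def]
  have xy: "x + y - q \<le> x + k * y - q" if "y \<ge> 0" for x y :: real
    using mult_right_mono[OF k that] by simp
  show "(\<integral>z. pos_part (fst z + snd z - q) \<partial>P) \<le> (b - 1) / (2 * b) * (m - (q - Qb q))"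
    if P: "P \<in> ambiguity_set \<theta>" for P
  proof (cases "Qb q = 0")
    case True
    \<comment> \<open>Here the affine function has zero second moment, so \<epsilon> can be sent to
      0.\<close>
    have "(\<integral>z. pos_part (fst z + snd z - q) \<partial>P) \<le> 0 + \<epsilon>" if \<epsilon>: "\<epsilon> > 0" for \<epsilon>
    proof -
      have "(\<integral>z. pos_part (fst z + snd z - q) \<partial>P) \<le> 0 * (\<mu>1 + \<mu>2 - q) + \<epsilon> + 1 / (4 * \<epsilon>) *
         (1\<^sup>2 * (a * \<mu>1\<^sup>2) + k\<^sup>2 * (b * \<mu>2\<^sup>2) + (q - Qb q)\<^sup>2 + 2 * 1 * k * (c * \<mu>1 * \<mu>2)
           - 2 * (q - Qb q) * 1 * \<mu>1 - 2 * (q - Qb q) * k * \<mu>2)"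
        using pos_part_le_eps_square[OF \<epsilon> xy] True by (intro payoff_le_square[OF P]) simp
      also have "\<dots> = \<epsilon> + 1 / (4 * \<epsilon>) * ((b - 1) / b * (q\<^sup>2 - 2 * q * m + R))"
        unfolding res by (simp only: True diff_0_right add_0_right mult_zero_left add_0_left mult_1)
      also have "\<dots> = 0 + \<epsilon>" unfolding Qb_zero(2)[OF True] by simp
      finally show ?thesis .
    qed
    then show ?thesis using True Qb_zero(1) by (simp add: field_le_epsilon)
  next
    case False
    then have Q0: "Qb q > 0" using Qb_nonneg[of q] by simp
    have "(\<integral>z. pos_part (fst z + snd z - q) \<partial>P) \<le> 0 * (\<mu>1 + \<mu>2 - q) + 0 + 1 / (4 * Qb q) *
         (1\<^sup>2 * (a * \<mu>1\<^sup>2) + k\<^sup>2 * (b * \<mu>2\<^sup>2) + (q - Qb q)\<^sup>2 + 2 * 1 * k * (c * \<mu>1 * \<mu>2)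
           - 2 * (q - Qb q) * 1 * \<mu>1 - 2 * (q - Qb q) * k * \<mu>2)"
    proof (rule payoff_le_square[OF P])
      fix x y :: real assume "x \<ge> 0" "y \<ge> 0"
      have "(x + k * y - q + Qb q)\<^sup>2 = (1 * x + k * y - (q - Qb q))\<^sup>2"
        by (simp add: power2_eq_square algebra_simps)
      then show "pos_part (x + y - q)
          \<le> 0 * (x + y - q) + 0 + 1 / (4 * Qb q) * (1 * x + k * y - (q - Qb q))\<^sup>2"
        using pos_part_le_square[OF Q0 xy[OF \<open>y \<ge> 0\<close>], of x] by simp
    qed
    also have "\<dots> = 1 / (4 * Qb q) * ((b - 1) / b * ((q - Qb q)\<^sup>2 - 2 * (q - Qb q) * m + R))"
      unfolding res by simp
    also have "(q - Qb q)\<^sup>2 - 2 * (q - Qb q) * m + R = 2 * Qb q * (m - (q - Qb q))"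
      using Qb_sq[of q] by (simp add: power2_eq_square algebra_simps)
    also have "1 / (4 * Qb q) * ((b - 1) / b * (2 * Qb q * (m - (q - Qb q)))) =
        (b - 1) / (2 * b) * (m - (q - Qb q))"
      using Q0 ab by (simp add: divide_simps)
    finally show ?thesis .
  qed
  show "\<exists>P\<in>ambiguity_set \<theta>. (b - 1) / (2 * b) * (m - (q - Qb q))
      \<le> (\<integral>z. pos_part (fst z + snd z - q) \<partial>P)"
  proof (cases "Qb q = 0")
    case True
    obtain P where P: "P \<in> ambiguity_set \<theta>" using nonempty by blast
    show ?thesis using payoff_ge(1)[OF P, of q] Qb_zero(1)[OF True] True by (intro bexI[OF _ P]) simp
  next
    case False
    then have Q0: "Qb q > 0" using Qb_nonneg[of q] by simp
    then have "pos_part (\<zeta>b q) = 0" using Q(2) by (simp add: pos_part_def)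
    then have "\<exists>P\<in>ambiguity_set \<theta>. (\<integral>z. pos_part (fst z + snd z - q) \<partial>P)
        = (b - 1) / (2 * b) * (m - (q - Qb q))"
      using axis_law_Qb[OF Q0] Q(1) by simp
    then show ?thesis by (rule bex_eq_imp_bex_le)
  qed
qed

lemma v_P_high:
  assumes q: "q > 0" and Q: "Qb q < q" "Qb q \<le> \<zeta>b q"
  shows "v_P q \<theta> = ereal ((b - 1) / (2 * b) * ((q + Qb q) - m) + \<mu>1 + \<mu>2 - q)"
proof (rule v_P_eqI)
  \<comment> \<open>Mirror image of the low regime: the affine function now vanishes at
    \<open>(q + Qb q, 0)\<close>, the regime condition says \<open>k \<le> 1\<close>, and the square
    majorises the put payoff, to which \<open>x + y - q\<close> is added.\<close>
  define k where "k = (q + Qb q - c * \<mu>1) / (b * \<mu>2)"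
  have k: "k \<le> 1" using Q(2) mu ab by (simp add: k_def \<zeta>_b_def field_simps)
  note res = residual_second_moment[OF k_def]
  have xy: "- (x + y - q) \<le> q - x - k * y" if "y \<ge> 0" for x y :: real
    using mult_right_mono[OF k that] by simp
  show "(\<integral>z. pos_part (fst z + snd z - q) \<partial>P) \<le> (b - 1) / (2 * b) * ((q + Qb q) - m) + \<mu>1 + \<mu>2 - q"
    if P: "P \<in> ambiguity_set \<theta>" for P
  proof (cases "Qb q = 0")
    case True
    have "(\<integral>z. pos_part (fst z + snd z - q) \<partial>P) \<le> (\<mu>1 + \<mu>2 - q) + \<epsilon>" if \<epsilon>: "\<epsilon> > 0" for \<epsilon>
    proof -
      have "(\<integral>z. pos_part (fst z + snd z - q) \<partial>P) \<le> 1 * (\<mu>1 + \<mu>2 - q) + \<epsilon> + 1 / (4 * \<epsilon>) *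
         (1\<^sup>2 * (a * \<mu>1\<^sup>2) + k\<^sup>2 * (b * \<mu>2\<^sup>2) + (q + Qb q)\<^sup>2 + 2 * 1 * k * (c * \<mu>1 * \<mu>2)
           - 2 * (q + Qb q) * 1 * \<mu>1 - 2 * (q + Qb q) * k * \<mu>2)"
      proof (rule payoff_le_square[OF P])
        fix x y :: real assume "x \<ge> 0" "y \<ge> 0"
        have "(q - x - k * y)\<^sup>2 = (1 * x + k * y - (q + Qb q))\<^sup>2"
          using True by (simp add: power2_eq_square algebra_simps)
        then show "pos_part (x + y - q)
            \<le> 1 * (x + y - q) + \<epsilon> + 1 / (4 * \<epsilon>) * (1 * x + k * y - (q + Qb q))\<^sup>2"
          using pos_part_le_eps_square[OF \<epsilon> xy[OF \<open>y \<ge> 0\<close>], of x] pos_part_reflect[of "x + y - q"] by simp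
      qed
      also have "\<dots> = \<mu>1 + \<mu>2 - q + \<epsilon> + 1 / (4 * \<epsilon>) * ((b - 1) / b * (q\<^sup>2 - 2 * q * m + R))"
        unfolding res by (simp only: True diff_0_right add_0_right mult_zero_left add_0_left mult_1)
      also have "\<dots> = \<mu>1 + \<mu>2 - q + \<epsilon>" unfolding Qb_zero(2)[OF True] by simp
      finally show ?thesis .
    qed
    then have "(\<integral>z. pos_part (fst z + snd z - q) \<partial>P) \<le> \<mu>1 + \<mu>2 - q" by (rule field_le_epsilon)
    then show ?thesis using True Qb_zero(1) by simp
  next
    case False
    then have Q0: "Qb q > 0" using Qb_nonneg[of q] by simp
    have "(\<integral>z. pos_part (fst z + snd z - q) \<partial>P) \<le> 1 * (\<mu>1 + \<mu>2 - q) + 0 + 1 / (4 * Qb q) *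
         (1\<^sup>2 * (a * \<mu>1\<^sup>2) + k\<^sup>2 * (b * \<mu>2\<^sup>2) + (q + Qb q)\<^sup>2 + 2 * 1 * k * (c * \<mu>1 * \<mu>2)
           - 2 * (q + Qb q) * 1 * \<mu>1 - 2 * (q + Qb q) * k * \<mu>2)"
    proof (rule payoff_le_square[OF P])
      fix x y :: real assume "x \<ge> 0" "y \<ge> 0"
      have "(q - x - k * y + Qb q)\<^sup>2 = (1 * x + k * y - (q + Qb q))\<^sup>2"
        by (simp add: power2_eq_square algebra_simps)
      then show "pos_part (x + y - q)
          \<le> 1 * (x + y - q) + 0 + 1 / (4 * Qb q) * (1 * x + k * y - (q + Qb q))\<^sup>2"
        using pos_part_le_square[OF Q0 xy[OF \<open>y \<ge> 0\<close>], of x] pos_part_reflect[of "x + y - q"] by simp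
    qed
    also have "\<dots> = \<mu>1 + \<mu>2 - q + 1 / (4 * Qb q) * ((b - 1) / b * ((q + Qb q)\<^sup>2 - 2 * (q + Qb q) * m + R))"
      unfolding res by simp
    also have "(q + Qb q)\<^sup>2 - 2 * (q + Qb q) * m + R = 2 * Qb q * ((q + Qb q) - m)"
      using Qb_sq[of q] by (simp add: power2_eq_square algebra_simps)
    also have "1 / (4 * Qb q) * ((b - 1) / b * (2 * Qb q * ((q + Qb q) - m))) =
        (b - 1) / (2 * b) * ((q + Qb q) - m)"
      using Q0 ab by (simp add: divide_simps)
    finally show ?thesis by simp
  qed
  show "\<exists>P\<in>ambiguity_set \<theta>. (b - 1) / (2 * b) * ((q + Qb q) - m) + \<mu>1 + \<mu>2 - q
      \<le> (\<integral>z. pos_part (fst z + snd z - q) \<partial>P)"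
  proof (cases "Qb q = 0")
    case True
    obtain P where P: "P \<in> ambiguity_set \<theta>" using nonempty by blast
    show ?thesis using payoff_ge(2)[OF P, of q] Qb_zero(1)[OF True] True by (intro bexI[OF _ P]) simp
  next
    case False
    then have Q0: "Qb q > 0" using Qb_nonneg[of q] by simp
    then have "pos_part (\<zeta>b q) = \<zeta>b q" using Q(2) by (simp add: pos_part_def)
    \<comment> \<open>The atom off the axis now pays \<open>\<zeta>b q\<close>. The two expressions
      agree because the mean excess splits as
      \<open>\<zeta>b q / b + (b - 1) / b * (m - q) = \<mu>1 + \<mu>2 - q\<close>.\<close>
    moreover have "\<zeta>b q / b + (b - 1) / (2 * b) * (m - (q - Qb q)) =
        (b - 1) / (2 * b) * ((q + Qb q) - m) + \<mu>1 + \<mu>2 - q"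
    proof -
      have "(b - 1) / (2 * b) * (m - (q - Qb q)) - (b - 1) / (2 * b) * ((q + Qb q) - m)
          = (b - 1) / b * m - (b - 1) / b * q"
        using ab by (simp add: divide_simps) (simp add: algebra_simps)
      moreover have "(b - 1) / b * m = (b - c) * \<mu>1 / b" using ab by simp
      moreover have "\<zeta>b q / b + ((b - c) * \<mu>1 / b - (b - 1) / b * q) = \<mu>1 + \<mu>2 - q"
        using ab by (simp add: \<zeta>_b_def field_simps)
      ultimately show ?thesis by linarith
    qed
    ultimately have "\<exists>P\<in>ambiguity_set \<theta>. (\<integral>z. pos_part (fst z + snd z - q) \<partial>P)
        = (b - 1) / (2 * b) * ((q + Qb q) - m) + \<mu>1 + \<mu>2 - q"
      using axis_law_Qb[OF Q0] Q(1) by (simp only: less_imp_le)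
    then show ?thesis by (rule bex_eq_imp_bex_le)
  qed
qed


section \<open>The regime of small \<open>q\<close>\<close>

text \<open>The first bound is \<open>psd\<close> expanded, the second is the inequality of
  arithmetic and geometric means. Together they upgrade a nonzero determinant to a positive
  one.\<close>

lemma det_nonneg: "a * b - c\<^sup>2 \<ge> a + b - 2 * c" "a + b - 2 * c \<ge> 0"
proof -
  show "a * b - c\<^sup>2 \<ge> a + b - 2 * c" using psd by (simp add: power2_eq_square algebra_simps)
  have "(2 * (c - 1))\<^sup>2 \<le> ((a - 1) + (b - 1))\<^sup>2"
    using psd zero_le_power2[of "(a - 1) - (b - 1)"] by (simp add: power2_eq_square algebra_simps)
  then have "2 * (c - 1) \<le> (a - 1) + (b - 1)" by (rule power2_le_imp_le) (use ab in simp)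
  then show "a + b - 2 * c \<ge> 0" by simp
qed

text \<open>Squaring the hypothesis cancels \<open>q^2\<close> and leaves
  \<open>2 * q * m \<le> R\<close>.\<close>

lemma Qb_ge_threshold:
  assumes "q > 0" "Qb q \<ge> q"
  shows "2 * q * (b - c) \<le> (a * b - c\<^sup>2) * \<mu>1"
proof -
  have "q\<^sup>2 \<le> (Qb q)\<^sup>2" using assms by (intro power_mono) auto
  then have "2 * q * m \<le> R" unfolding Qb_sq by simp
  then have "(b - 1) * (2 * q * m) \<le> (b - 1) * R" using ab by (intro mult_left_mono) auto
  moreover have "(b - 1) * (2 * q * m) = 2 * q * (b - c) * \<mu>1" "(b - 1) * R = (a * b - c\<^sup>2) * \<mu>1 * \<mu>1"
    using ab by (simp_all add: power2_eq_square)
  ultimately show ?thesis using mu(1) by (metis mult_le_cancel_right_pos)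
qed

lemma v_P_small_upper:
  assumes q: "q > 0" and D: "a * b - c\<^sup>2 > 0"
    and s: "2 * q * (b - c) \<le> (a * b - c\<^sup>2) * \<mu>1" and t: "2 * q * (a - c) \<le> (a * b - c\<^sup>2) * \<mu>2"
    and P: "P \<in> ambiguity_set \<theta>"
  shows "(\<integral>z. pos_part (fst z + snd z - q) \<partial>P) \<le> \<mu>1 + \<mu>2 - q * ((a + b - 2 * c) / (a * b - c\<^sup>2))"
proof -
  define D where "D = a * b - c\<^sup>2"
  \<comment> \<open>Cramer's rule for the normal equations: \<open>s * X1 + t * X2\<close> is the
    mean square best approximation of the constant 1.\<close>
  define s t where "s = (b - c) / (D * \<mu>1)" and "t = (a - c) / (D * \<mu>2)"
  have D0: "D > 0" using D by (simp add: D_def)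
  have st: "2 * q * s \<le> 1" "2 * q * t \<le> 1"
    using assms mu by (simp_all add: s_def t_def D_def field_simps)
  have "(\<integral>z. pos_part (fst z + snd z - q) \<partial>P) \<le> 1 * (\<mu>1 + \<mu>2 - q) + 0 + q *
     (s\<^sup>2 * (a * \<mu>1\<^sup>2) + t\<^sup>2 * (b * \<mu>2\<^sup>2) + 1\<^sup>2 + 2 * s * t * (c * \<mu>1 * \<mu>2) - 2 * 1 * s * \<mu>1 - 2 * 1 * t * \<mu>2)"
  proof (rule payoff_le_square[OF P])
    fix x y :: real assume xy: "x \<ge> 0" "y \<ge> 0"
    have less: "- w \<le> A - B + q" if "0 \<le> A" "B \<le> w + q" for A B w :: real
      using that by simp
    have pos: "pos_part w \<le> 1 * w + 0 + T" if "0 \<le> T" "- w \<le> T" for w T :: real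
      using that by (simp add: pos_part_def)
    have "2 * q * s * x + 2 * q * t * y \<le> 1 * x + 1 * y"
      using st xy by (intro add_mono mult_right_mono) auto
    \<comment> \<open>Below the threshold the expanded square must exceed \<open>q - x - y\<close>;
      its constant and linear terms already do. Above it, nonnegativity of the square
      suffices.\<close>
    then have "2 * q * s * x + 2 * q * t * y \<le> (x + y - q) + q" by simp
    moreover have "0 \<le> q * (s * x + t * y)\<^sup>2" "0 \<le> q * (s * x + t * y - 1)\<^sup>2" using q by simp_all
    moreover have "q * (s * x + t * y - 1)\<^sup>2 = q * (s * x + t * y)\<^sup>2 - (2 * q * s * x + 2 * q * t * y) + q"
      by (simp add: power2_eq_square algebra_simps)
    ultimately show "pos_part (x + y - q) \<le> 1 * (x + y - q) + 0 + q * (s * x + t * y - 1)\<^sup>2"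
      by (intro pos) (simp_all only: less)
  qed
  also have "s\<^sup>2 * (a * \<mu>1\<^sup>2) + t\<^sup>2 * (b * \<mu>2\<^sup>2) + 1\<^sup>2 + 2 * s * t * (c * \<mu>1 * \<mu>2) - 2 * 1 * s * \<mu>1 - 2 * 1 * t * \<mu>2
     = 1 - (a + b - 2 * c) / D"
  proof -
    have s1: "s * \<mu>1 = (b - c) / D" and t1: "t * \<mu>2 = (a - c) / D" using mu by (simp_all add: s_def t_def)
    have "s\<^sup>2 * (a * \<mu>1\<^sup>2) + t\<^sup>2 * (b * \<mu>2\<^sup>2) + 1\<^sup>2 + 2 * s * t * (c * \<mu>1 * \<mu>2) - 2 * 1 * s * \<mu>1 - 2 * 1 * t * \<mu>2
      = a * (s * \<mu>1)\<^sup>2 + b * (t * \<mu>2)\<^sup>2 + 1 + 2 * c * (s * \<mu>1) * (t * \<mu>2) - 2 * (s * \<mu>1) - 2 * (t * \<mu>2)"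
      by (simp add: power2_eq_square algebra_simps)
    also have "\<dots> = (a * (b - c)\<^sup>2 + b * (a - c)\<^sup>2 + 2 * c * (b - c) * (a - c)) / D\<^sup>2 + 1 - 2 * (a + b - 2 * c) / D"
      unfolding s1 t1 using D0 by (simp add: field_simps power2_eq_square)
    also have "a * (b - c)\<^sup>2 + b * (a - c)\<^sup>2 + 2 * c * (b - c) * (a - c) = (a + b - 2 * c) * D"
      by (simp add: D_def power2_eq_square algebra_simps)
    also have "(a + b - 2 * c) * D / D\<^sup>2 = (a + b - 2 * c) / D" using D0 by (simp add: power2_eq_square)
    finally show ?thesis by simp
  qed
  also have "1 * (\<mu>1 + \<mu>2 - q) + 0 + q * (1 - (a + b - 2 * c) / D) = \<mu>1 + \<mu>2 - q * ((a + b - 2 * c) / D)"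
    by (simp add: right_diff_distrib)
  finally show ?thesis by (simp only: D_def)
qed

text \<open>The majorant touches the payoff at the origin and where \<open>s * x + t * y = 1\<close>
  above the threshold. That line contains \<open>(c * \<mu>1, b * \<mu>2)\<close> and, for
  \<open>b > c\<close>, meets the positive first axis.\<close>

lemma v_P_small_attained:
  assumes q: "q > 0" and D: "a * b - c\<^sup>2 > 0"
    and s: "2 * q * (b - c) \<le> (a * b - c\<^sup>2) * \<mu>1" and t: "2 * q * (a - c) \<le> (a * b - c\<^sup>2) * \<mu>2"
    and bc: "b > c"
  shows "\<exists>P\<in>ambiguity_set \<theta>. (\<integral>z. pos_part (fst z + snd z - q) \<partial>P)
           = \<mu>1 + \<mu>2 - q * ((a + b - 2 * c) / (a * b - c\<^sup>2))"
proof -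
  define D where "D = a * b - c\<^sup>2"
  \<comment> \<open>The third atom is the origin, so the axis moments force \<open>x = R / m\<close>
    and \<open>p = (b - 1) / b * m^2 / R\<close>.\<close>
  define p x where "p = (b - c)\<^sup>2 / (b * D)" and "x = D * \<mu>1 / (b - c)"
  have D0: "D > 0" using D by (simp add: D_def)
  have R: "(b - 1) / b * R = D * \<mu>1\<^sup>2 / b" and M: "(b - 1) / b * m = (b - c) * \<mu>1 / b"
    using ab by (simp_all add: D_def)
  have px: "p * x = (b - c) * \<mu>1 / b"
    using ab D0 bc by (simp add: p_def x_def power2_eq_square)
  have pxx: "p * x\<^sup>2 = D * \<mu>1\<^sup>2 / b"
    using ab D0 bc by (simp add: p_def x_def power2_eq_square)
  have xq: "x \<ge> 2 * q" using s bc by (simp add: x_def D_def field_simps)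
  have p1: "p \<le> (b - 1) / b"
  proof -
    have "(b - 1) * D - (b - c)\<^sup>2 = b * ((a - 1) * (b - 1) - (c - 1)\<^sup>2)"
      by (simp add: D_def power2_eq_square algebra_simps)
    also have "\<dots> \<ge> 0" using ab psd by simp
    finally have "(b - c)\<^sup>2 \<le> (b - 1) * D" by simp
    then have "(b - c)\<^sup>2 / (b * D) \<le> (b - 1) * D / (b * D)"
      using ab D0 by (intro divide_right_mono) auto
    then show ?thesis using D0 by (simp add: p_def)
  qed
  have "\<exists>P\<in>ambiguity_set \<theta>. (\<integral>z. pos_part (fst z + snd z - q) \<partial>P) =
           pos_part (\<zeta>b q) / b + p * pos_part (x - q) + ((b - 1) / b - p) * pos_part (0 - q)"
  proof (rule axis_law)
    show "p * x + ((b - 1) / b - p) * 0 = (b - 1) / b * m" unfolding M px by simp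
    show "p * x\<^sup>2 + ((b - 1) / b - p) * 0\<^sup>2 = (b - 1) / b * R" unfolding R pxx by simp
  qed (use p1 xq q ab D0 in \<open>auto simp: p_def\<close>)
  also have "pos_part (\<zeta>b q) / b + p * pos_part (x - q) + ((b - 1) / b - p) * pos_part (0 - q)
      = \<mu>1 + \<mu>2 - q * ((a + b - 2 * c) / D)"
  proof -
    \<comment> \<open>Weighting the two thresholds by \<open>c\<close> and \<open>b\<close> gives
      \<open>2 * q \<le> c * \<mu>1 + b * \<mu>2\<close>, so the atom off the axis pays.\<close>
    have "c * (2 * q * (b - c)) + b * (2 * q * (a - c)) \<le> c * (D * \<mu>1) + b * (D * \<mu>2)"
      using s t c ab by (intro add_mono mult_left_mono) (auto simp: D_def)
    then have "D * (2 * q) \<le> D * (c * \<mu>1 + b * \<mu>2)"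
      by (simp add: D_def power2_eq_square algebra_simps)
    then have "\<zeta>b q \<ge> 0" using D0 q by (simp add: \<zeta>_b_def)
    then have "pos_part (\<zeta>b q) / b + p * pos_part (x - q) + ((b - 1) / b - p) * pos_part (0 - q)
       = \<zeta>b q / b + p * x - q * p" using xq q by (simp add: pos_part_def algebra_simps)
    also have "\<dots> = \<mu>1 + \<mu>2 - q * (1 / b + p)"
      unfolding px using ab by (simp add: \<zeta>_b_def field_simps)
    also have "1 / b + p = (D + (b - c)\<^sup>2) / (b * D)"
      using ab D0 by (simp add: p_def field_simps)
    also have "D + (b - c)\<^sup>2 = b * (a + b - 2 * c)" by (simp add: D_def power2_eq_square algebra_simps)
    also have "b * (a + b - 2 * c) / (b * D) = (a + b - 2 * c) / D" using ab by simp
    finally show ?thesis .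
  qed
  finally show ?thesis by (simp only: D_def)
qed

text \<open>Carries every result on \<open>Qb\<close> over to \<open>Q_a\<close>.\<close>

lemma swapped: "moment_problem \<mu>2 \<mu>1 b a c"
proof
  show "ambiguity_set (\<mu>2, \<mu>1, b * \<mu>2\<^sup>2, a * \<mu>1\<^sup>2, c * \<mu>2 * \<mu>1) \<noteq> {}"
    using nonempty ambiguity_set_swap[of _ \<mu>1 \<mu>2 "a * \<mu>1\<^sup>2" "b * \<mu>2\<^sup>2" "c * \<mu>1 * \<mu>2"]
    by (auto simp: mult.commute mult.left_commute)
qed (use mu ab c psd in \<open>simp_all add: mult.commute\<close>)

lemma swap_simps:
  "v_P q (\<mu>2, \<mu>1, b * \<mu>2\<^sup>2, a * \<mu>1\<^sup>2, c * \<mu>2 * \<mu>1) = v_P q \<theta>"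
  "Q_b b a c \<mu>2 q = Q_a a b c \<mu>2 q" "\<zeta>_b a c \<mu>2 \<mu>1 q = \<zeta>_a a c \<mu>1 \<mu>2 q"
proof -
  show "v_P q (\<mu>2, \<mu>1, b * \<mu>2\<^sup>2, a * \<mu>1\<^sup>2, c * \<mu>2 * \<mu>1) = v_P q \<theta>"
    by (subst v_P_swap) (simp add: ac_simps)
qed (simp_all add: Q_a_def Q_b_def \<zeta>_a_def \<zeta>_b_def ac_simps)

lemma v_P_small:
  assumes q: "q > 0" and D: "a * b - c\<^sup>2 \<noteq> 0" and Q: "Q_a a b c \<mu>2 q \<ge> q" "Qb q \<ge> q"
  shows "v_P q \<theta> = ereal (\<mu>1 + \<mu>2 - q * ((a + b - 2 * c) / (a * b - c\<^sup>2)))"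
proof -
  interpret sw: moment_problem \<mu>2 \<mu>1 b a c by (rule swapped)
  have D0: "a * b - c\<^sup>2 > 0" using det_nonneg D by linarith
  have s: "2 * q * (b - c) \<le> (a * b - c\<^sup>2) * \<mu>1" by (rule Qb_ge_threshold[OF q Q(2)])
  have t: "2 * q * (a - c) \<le> (a * b - c\<^sup>2) * \<mu>2"
    using sw.Qb_ge_threshold[OF q] Q(1) by (simp add: swap_simps mult.commute)
  show ?thesis
  \<comment> \<open>A positive determinant rules out that both \<open>a\<close> and \<open>b\<close>
    are at most \<open>c\<close>, so one of the two axes can carry the atom.\<close>
  proof (cases "b > c")
    case True
    show ?thesis
    proof (rule v_P_eqI)
      show "\<exists>P\<in>ambiguity_set \<theta>. \<mu>1 + \<mu>2 - q * ((a + b - 2 * c) / (a * b - c\<^sup>2))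
          \<le> (\<integral>z. pos_part (fst z + snd z - q) \<partial>P)"
        by (rule bex_eq_imp_bex_le[OF v_P_small_attained[OF q D0 s t True]])
    qed (rule v_P_small_upper[OF q D0 s t])
  next
    case False
    have "a > c"
    proof (rule ccontr)
      assume "\<not> a > c"
      with False ab have "a * b \<le> c * c" by (intro mult_mono) auto
      with D0 show False by (simp add: power2_eq_square)
    qed
    note small = q D0[unfolded mult.commute[of a b]] t[unfolded mult.commute[of a b]] s[unfolded mult.commute[of a b]]
    have "v_P q (\<mu>2, \<mu>1, b * \<mu>2\<^sup>2, a * \<mu>1\<^sup>2, c * \<mu>2 * \<mu>1) = ereal (\<mu>2 + \<mu>1 - q * ((b + a - 2 * c) / (b * a - c\<^sup>2)))"
    proof (rule v_P_eqI)
      show "\<exists>P\<in>ambiguity_set sw.\<theta>. \<mu>2 + \<mu>1 - q * ((b + a - 2 * c) / (b * a - c\<^sup>2))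
          \<le> (\<integral>z. pos_part (fst z + snd z - q) \<partial>P)"
        by (rule bex_eq_imp_bex_le[OF sw.v_P_small_attained[OF small \<open>a > c\<close>]])
    qed (rule sw.v_P_small_upper[OF small])
    then show ?thesis unfolding swap_simps by (simp add: ac_simps)
  qed
qed

section \<open>The middle regime\<close>

text \<open>Pythagoras for projecting \<open>X1 + X2 - q\<close> onto \<open>X2\<close>: their inner
  product is \<open>\<mu>2 * \<zeta>b q\<close>, so the projection contributes
  \<open>(\<zeta>b q)^2 / b\<close> and the residual \<open>(b - 1) / b * (Qb q)^2\<close>.\<close>

lemma Qb_conv_Qc:
  "b * (q\<^sup>2 - 2 * q * (\<mu>1 + \<mu>2) + a * \<mu>1\<^sup>2 + b * \<mu>2\<^sup>2 + 2 * c * \<mu>1 * \<mu>2) = (b - 1) * (Qb q)\<^sup>2 + (\<zeta>b q)\<^sup>2"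
proof -
  have "(b - 1) * (q\<^sup>2 - 2 * q * M + N) = (b - 1) * q\<^sup>2 - 2 * q * ((b - 1) * M) + (b - 1) * N" for M N
    by (simp add: algebra_simps)
  then have "(b - 1) * (Qb q)\<^sup>2 = (b - 1) * q\<^sup>2 - 2 * q * ((b - 1) * m) + (b - 1) * R"
    unfolding Qb_sq .
  also have "(b - 1) * m = (b - c) * \<mu>1" using ab by simp
  also have "(b - 1) * R = (a * b - c\<^sup>2) * \<mu>1\<^sup>2" using ab by simp
  finally show ?thesis by (simp add: \<zeta>_b_def power2_eq_square algebra_simps)
qed

lemma Qc_sq: "(Q_c a b c \<mu>1 \<mu>2 q)\<^sup>2 = q\<^sup>2 - 2 * q * (\<mu>1 + \<mu>2) + a * \<mu>1\<^sup>2 + b * \<mu>2\<^sup>2 + 2 * c * \<mu>1 * \<mu>2"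
proof -
  have "b * (q\<^sup>2 - 2 * q * (\<mu>1 + \<mu>2) + a * \<mu>1\<^sup>2 + b * \<mu>2\<^sup>2 + 2 * c * \<mu>1 * \<mu>2) \<ge> 0"
    unfolding Qb_conv_Qc using ab by simp
  then show ?thesis using ab by (simp add: Q_c_def zero_le_mult_iff)
qed

lemma Qc_nonneg: "Q_c a b c \<mu>1 \<mu>2 q \<ge> 0"
  using Qc_sq[of q] zero_le_power2[of "Q_c a b c \<mu>1 \<mu>2 q"] by (simp add: Q_c_def)

lemma zeta_lt_Qc:
  assumes "\<bar>\<zeta>b q\<bar> < Qb q"
  shows "\<bar>\<zeta>b q\<bar> < Q_c a b c \<mu>1 \<mu>2 q"
proof -
  have "(\<zeta>b q)\<^sup>2 < (Qb q)\<^sup>2" using assms power_strict_mono[of "\<bar>\<zeta>b q\<bar>" "Qb q" 2] by simp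
  then have "(b - 1) * (\<zeta>b q)\<^sup>2 < (b - 1) * (Qb q)\<^sup>2" using ab by simp
  then have "b * (\<zeta>b q)\<^sup>2 < b * (Q_c a b c \<mu>1 \<mu>2 q)\<^sup>2"
    unfolding Qc_sq Qb_conv_Qc by (simp add: algebra_simps)
  then have "\<bar>\<zeta>b q\<bar>\<^sup>2 < (Q_c a b c \<mu>1 \<mu>2 q)\<^sup>2" using ab by simp
  then show ?thesis using Qc_nonneg by (rule power2_less_imp_less)
qed

lemma v_P_middle:
  assumes q: "q > 0" and Qa: "\<bar>\<zeta>_a a c \<mu>1 \<mu>2 q\<bar> < Q_a a b c \<mu>2 q" and Qb: "\<bar>\<zeta>b q\<bar> < Qb q"
  shows "v_P q \<theta> = ereal (1 / 2 * (Q_c a b c \<mu>1 \<mu>2 q - q + \<mu>1 + \<mu>2))"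
proof -
  interpret sw: moment_problem \<mu>2 \<mu>1 b a c by (rule swapped)
  define Q where "Q = Q_c a b c \<mu>1 \<mu>2 q"
  \<comment> \<open>With \<open>W = X1 + X2 - q\<close>: \<open>e = E[W]\<close>,
    \<open>\<mu>1 * za = E[X1 * W]\<close>, \<open>\<mu>2 * zb = E[X2 * W]\<close>, and
    \<open>Q^2 = E[W^2]\<close>.\<close>
  define za zb e where "za = \<zeta>_a a c \<mu>1 \<mu>2 q" and "zb = \<zeta>b q" and "e = \<mu>1 + \<mu>2 - q"
  have zb: "\<bar>zb\<bar> < Q" using zeta_lt_Qc[OF Qb] by (simp add: zb_def Q_def)
  have "Q_c b a c \<mu>2 \<mu>1 q = Q" by (simp add: Q_def Q_c_def ac_simps)
  then have za: "\<bar>za\<bar> < Q" using sw.zeta_lt_Qc[of q] Qa by (simp add: za_def swap_simps)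
  have Q0: "Q > 0" using zb by simp
  have Qsq: "Q\<^sup>2 = q\<^sup>2 - 2 * q * (\<mu>1 + \<mu>2) + a * \<mu>1\<^sup>2 + b * \<mu>2\<^sup>2 + 2 * c * \<mu>1 * \<mu>2"
    unfolding Q_def by (rule Qc_sq)
  have var: "Q\<^sup>2 - e\<^sup>2 = (a - 1) * \<mu>1\<^sup>2 + (b - 1) * \<mu>2\<^sup>2 + 2 * (c - 1) * \<mu>1 * \<mu>2"
    unfolding Qsq e_def by (simp add: power2_eq_square algebra_simps)
  have cov: "(b - 1) * (Q\<^sup>2 - e\<^sup>2) - (zb - e)\<^sup>2 = ((a - 1) * (b - 1) - (c - 1)\<^sup>2) * \<mu>1\<^sup>2"
    unfolding var unfolding zb_def e_def \<zeta>_b_def by (simp add: power2_eq_square algebra_simps)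
  \<comment> \<open>Cauchy-Schwarz for the covariance \<open>\<mu>2 * (zb - e)\<close> of
    \<open>X2\<close> with the sum, whose variance is \<open>Q^2 - e^2\<close>.\<close>
  have schur: "(zb - e)\<^sup>2 \<le> (b - 1) * (Q\<^sup>2 - e\<^sup>2)"
  proof -
    have "0 \<le> (b - 1) * (Q\<^sup>2 - e\<^sup>2) - (zb - e)\<^sup>2" unfolding cov using psd by simp
    then show ?thesis by simp
  qed
  have "0 \<le> (b - 1) * (Q\<^sup>2 - e\<^sup>2)" using schur zero_le_power2 order_trans by blast
  then have "\<bar>e\<bar>\<^sup>2 \<le> Q\<^sup>2" using ab by (simp add: zero_le_mult_iff)
  then have eQ: "\<bar>e\<bar> \<le> Q" by (rule power2_le_imp_le) (use Q0 in simp)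
  have SS: "\<mu>1 * za + \<mu>2 * zb = Q\<^sup>2 + q * e"
    unfolding Qsq za_def zb_def e_def \<zeta>_a_def \<zeta>_b_def by (simp add: power2_eq_square algebra_simps)
  \<comment> \<open>If \<open>W\<close> takes only the values \<open>Q\<close> and
    \<open>- Q\<close>, the indicator of the upper line is \<open>(Q + W) / (2 * Q)\<close>. Its
    expectation and its products with the coordinates give \<open>p\<close>, \<open>x\<close>,
    \<open>y\<close>; \<open>r\<close>, \<open>u\<close>, \<open>v\<close> belong to the lower
    line.\<close>
  define p r x y u v where "p = (Q + e) / (2 * Q)" and "r = (Q - e) / (2 * Q)"
    and "x = \<mu>1 * (Q + za) / (2 * Q)" and "y = \<mu>2 * (Q + zb) / (2 * Q)"
    and "u = \<mu>1 * (Q - za) / (2 * Q)" and "v = \<mu>2 * (Q - zb) / (2 * Q)"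
  note defs = p_def r_def x_def y_def u_def v_def
  have pos: "x > 0" "y > 0" "u > 0" "v > 0" "p \<ge> 0" "r \<ge> 0"
    unfolding defs using mu za zb eQ Q0 by (auto intro!: divide_pos_pos mult_pos_pos divide_nonneg_nonneg)
  have sums: "p + r = 1" "x + u = \<mu>1" "y + v = \<mu>2"
    unfolding defs using Q0 by (simp_all add: field_simps)
  have hp: "x + y = (q + Q) * p"
  proof -
    have "\<mu>1 * (Q + za) + \<mu>2 * (Q + zb) = (\<mu>1 + \<mu>2) * Q + (\<mu>1 * za + \<mu>2 * zb)" by (simp add: algebra_simps)
    also have "\<dots> = (q + Q) * (Q + e)" unfolding SS e_def by (simp add: power2_eq_square algebra_simps)
    finally show ?thesis unfolding defs by (simp add: add_divide_distrib[symmetric])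
  qed
  have lr: "u + v = (q - Q) * r"
  proof -
    have "\<mu>1 * (Q - za) + \<mu>2 * (Q - zb) = (\<mu>1 + \<mu>2) * Q - (\<mu>1 * za + \<mu>2 * zb)" by (simp add: algebra_simps)
    also have "\<dots> = (q - Q) * (Q - e)" unfolding SS e_def by (simp add: power2_eq_square algebra_simps)
    finally show ?thesis unfolding defs by (simp add: add_divide_distrib[symmetric])
  qed
  have "(q + Q) * p > 0" using hp[symmetric] pos by simp
  then have p0: "p > 0" using q Q0 by (simp add: zero_less_mult_iff)
  \<comment> \<open>Positive first moments on the lower line force that line to have mass and to
    meet the open quadrant.\<close>
  have "(q - Q) * r > 0" using lr[symmetric] pos by simp
  then have r0: "r > 0" and l0: "q - Q > 0" using pos by (auto simp: zero_less_mult_iff)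
  show ?thesis
  proof (rule v_P_eqI)
    fix P assume P: "P \<in> ambiguity_set \<theta>"
    have "(\<integral>z. pos_part (fst z + snd z - q) \<partial>P) \<le> 0 * (\<mu>1 + \<mu>2 - q) + 0 + 1 / (4 * Q) *
        (1\<^sup>2 * (a * \<mu>1\<^sup>2) + 1\<^sup>2 * (b * \<mu>2\<^sup>2) + (q - Q)\<^sup>2 + 2 * 1 * 1 * (c * \<mu>1 * \<mu>2)
          - 2 * (q - Q) * 1 * \<mu>1 - 2 * (q - Q) * 1 * \<mu>2)"
    proof (rule payoff_le_square[OF P])
      fix x y :: real
      have "(x + y - q + Q)\<^sup>2 = (1 * x + 1 * y - (q - Q))\<^sup>2"
        by (simp add: power2_eq_square algebra_simps)
      then show "pos_part (x + y - q)
          \<le> 0 * (x + y - q) + 0 + 1 / (4 * Q) * (1 * x + 1 * y - (q - Q))\<^sup>2"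
        using pos_part_le_square[OF Q0 order_refl, of "x + y - q"] by simp
    qed
    also have "1\<^sup>2 * (a * \<mu>1\<^sup>2) + 1\<^sup>2 * (b * \<mu>2\<^sup>2) + (q - Q)\<^sup>2 + 2 * 1 * 1 * (c * \<mu>1 * \<mu>2)
          - 2 * (q - Q) * 1 * \<mu>1 - 2 * (q - Q) * 1 * \<mu>2 = 2 * Q * (Q + e)"
      using Qsq by (simp add: e_def power2_eq_square algebra_simps)
    also have "0 * (\<mu>1 + \<mu>2 - q) + 0 + 1 / (4 * Q) * (2 * Q * (Q + e)) = 1 / 2 * (Q + e)" using Q0 by simp
    finally show "(\<integral>z. pos_part (fst z + snd z - q) \<partial>P) \<le> 1 / 2 * (Q_c a b c \<mu>1 \<mu>2 q - q + \<mu>1 + \<mu>2)"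
      by (simp add: Q_def e_def)
  next
    \<comment> \<open>The left side is the second moment of the conditional mean of
      \<open>X2\<close> given the line, namely
      \<open>\<mu>2^2 + (y - p * \<mu>2)^2 / (p * r)\<close>; \<open>schur\<close> bounds
      it.\<close>
    have yv: "y\<^sup>2 / p + v\<^sup>2 / r \<le> b * \<mu>2\<^sup>2"
    proof -
      have v: "v = \<mu>2 - y" and r: "r = 1 - p" using sums by simp_all
      have "y - p * \<mu>2 = \<mu>2 * ((zb - e) / (2 * Q))"
        unfolding y_def p_def using Q0 by (simp add: field_simps)
      then have "(y - p * \<mu>2)\<^sup>2 = (\<mu>2 * ((zb - e) / (2 * Q)))\<^sup>2" by simp
      also have "\<dots> = \<mu>2\<^sup>2 * ((zb - e)\<^sup>2 / (2 * Q)\<^sup>2)" by (simp add: power_mult_distrib power_divide)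
      also have "\<dots> \<le> \<mu>2\<^sup>2 * ((b - 1) * (Q\<^sup>2 - e\<^sup>2) / (2 * Q)\<^sup>2)"
        using schur by (intro mult_left_mono divide_right_mono) auto
      also have "\<dots> = (b - 1) * \<mu>2\<^sup>2 * (p * r)"
        unfolding p_def r_def using Q0 by (simp add: field_simps power2_eq_square)
      finally have "(y - p * \<mu>2)\<^sup>2 + \<mu>2\<^sup>2 * (p * r) \<le> b * \<mu>2\<^sup>2 * (p * r)" by (simp add: algebra_simps)
      moreover have "y\<^sup>2 * r + v\<^sup>2 * p = (y - p * \<mu>2)\<^sup>2 + \<mu>2\<^sup>2 * (p * r)"
        unfolding v r by (simp add: power2_eq_square algebra_simps)
      ultimately have "(y\<^sup>2 * r + v\<^sup>2 * p) / (p * r) \<le> b * \<mu>2\<^sup>2"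
        using p0 r0 by (simp add: pos_divide_le_eq)
      moreover have "(y\<^sup>2 * r + v\<^sup>2 * p) / (p * r) = y\<^sup>2 / p + v\<^sup>2 / r"
        using p0 r0 by (simp add: field_simps)
      ultimately show ?thesis by simp
    qed
    have Qx: "Q * (x - u) = \<mu>1 * za" and Qy: "Q * (y - v) = \<mu>2 * zb"
      unfolding defs using Q0 by (simp_all add: field_simps)
    have "(q + Q) * x + (q - Q) * u = q * (x + u) + Q * (x - u)" by (simp add: algebra_simps)
    also have "\<dots> = a * \<mu>1\<^sup>2 + c * \<mu>1 * \<mu>2"
      unfolding Qx sums za_def \<zeta>_a_def by (simp add: power2_eq_square algebra_simps)
    finally have hx: "(q + Q) * x + (q - Q) * u = a * \<mu>1\<^sup>2 + c * \<mu>1 * \<mu>2" .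
    have "(q + Q) * y + (q - Q) * v = q * (y + v) + Q * (y - v)" by (simp add: algebra_simps)
    also have "\<dots> = c * \<mu>1 * \<mu>2 + b * \<mu>2\<^sup>2"
      unfolding Qy sums zb_def \<zeta>_b_def by (simp add: power2_eq_square algebra_simps)
    finally have hy: "(q + Q) * y + (q - Q) * v = c * \<mu>1 * \<mu>2 + b * \<mu>2\<^sup>2" .
    have "\<exists>P\<in>ambiguity_set \<theta>. (\<integral>z. pos_part (fst z + snd z - q) \<partial>P) = p * (q + Q - q)"
      by (rule two_line_law[OF p0 r0 _ l0 _ _ _ _ sums(1) hp lr sums(2,3) hx hy yv])
        (use pos q Q0 c mu in simp_all)
    moreover have "p * (q + Q - q) = 1 / 2 * (Q_c a b c \<mu>1 \<mu>2 q - q + \<mu>1 + \<mu>2)"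
      using Q0 by (simp add: p_def e_def Q_def)
    ultimately show "\<exists>P\<in>ambiguity_set \<theta>. 1 / 2 * (Q_c a b c \<mu>1 \<mu>2 q - q + \<mu>1 + \<mu>2)
        \<le> (\<integral>z. pos_part (fst z + snd z - q) \<partial>P)" by (simp only: bex_eq_imp_bex_le)
  qed
qed

end

(* If a * b = c^2, the hypotheses force a = b = c and the quotient in the first item reads 0 / 0;
   that item therefore assumes that its denominator does not vanish. *)
theorem theorem1:
  fixes \<mu>1 \<mu>2 a b c q :: real and \<theta> :: "real \<times> real \<times> real \<times> real \<times> real"
  assumes "\<mu>1 > 0" and "\<mu>2 > 0"
    and "a > 1" and "b > 1" and "c \<ge> 0"
    and "(a - 1) * (b - 1) \<ge> (c - 1)\<^sup>2"
    and "\<theta> = (\<mu>1, \<mu>2, a * \<mu>1\<^sup>2, b * \<mu>2\<^sup>2, c * \<mu>1 * \<mu>2)"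
    and "ambiguity_set \<theta> \<noteq> {}"
    and "q > 0"
  shows
    "(a * b - c\<^sup>2 \<noteq> 0 \<and> Q_a a b c \<mu>2 q \<ge> q \<and> Q_b a b c \<mu>1 q \<ge> q \<longrightarrow>
        v_P q \<theta> = ereal (\<mu>1 + \<mu>2 - q * ((a + b - 2 * c) / (a * b - c\<^sup>2)))) \<and>
     (Q_b a b c \<mu>1 q < q \<and> Q_b a b c \<mu>1 q \<le> \<zeta>_b b c \<mu>1 \<mu>2 q \<longrightarrow>
        v_P q \<theta> = ereal ((b - 1) / (2 * b) * ((q + Q_b a b c \<mu>1 q) - (b - c) / (b - 1) * \<mu>1)
                         + \<mu>1 + \<mu>2 - q)) \<and>
     (Q_a a b c \<mu>2 q < q \<and> Q_a a b c \<mu>2 q \<le> \<zeta>_a a c \<mu>1 \<mu>2 q \<longrightarrow>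
        v_P q \<theta> = ereal ((a - 1) / (2 * a) * ((q + Q_a a b c \<mu>2 q) - (a - c) / (a - 1) * \<mu>2)
                         + \<mu>1 + \<mu>2 - q)) \<and>
     (Q_b a b c \<mu>1 q < q \<and> Q_b a b c \<mu>1 q \<le> - \<zeta>_b b c \<mu>1 \<mu>2 q \<longrightarrow>
        v_P q \<theta> = ereal ((b - 1) / (2 * b) * ((b - c) / (b - 1) * \<mu>1 - (q - Q_b a b c \<mu>1 q)))) \<and>
     (Q_a a b c \<mu>2 q < q \<and> Q_a a b c \<mu>2 q \<le> - \<zeta>_a a c \<mu>1 \<mu>2 q \<longrightarrow>
        v_P q \<theta> = ereal ((a - 1) / (2 * a) * ((a - c) / (a - 1) * \<mu>2 - (q - Q_a a b c \<mu>2 q)))) \<and>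
     (Q_a a b c \<mu>2 q > \<bar>\<zeta>_a a c \<mu>1 \<mu>2 q\<bar> \<and> Q_b a b c \<mu>1 q > \<bar>\<zeta>_b b c \<mu>1 \<mu>2 q\<bar> \<longrightarrow>
        v_P q \<theta> = ereal (1 / 2 * (Q_c a b c \<mu>1 \<mu>2 q - q + \<mu>1 + \<mu>2)))"
proof -
  interpret moment_problem \<mu>1 \<mu>2 a b c by unfold_locales (use assms in auto)
  \<comment> \<open>The exchanged instance yields the two items on \<open>Q_a < q\<close>.\<close>
  interpret sw: moment_problem \<mu>2 \<mu>1 b a c by (rule swapped)
  note q = \<open>q > 0\<close>
  have high: "Q_a a b c \<mu>2 q < q \<Longrightarrow> Q_a a b c \<mu>2 q \<le> \<zeta>_a a c \<mu>1 \<mu>2 q \<Longrightarrow>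
      v_P q (\<mu>1, \<mu>2, a * \<mu>1\<^sup>2, b * \<mu>2\<^sup>2, c * \<mu>1 * \<mu>2) =
        ereal ((a - 1) / (2 * a) * ((q + Q_a a b c \<mu>2 q) - (a - c) / (a - 1) * \<mu>2) + \<mu>1 + \<mu>2 - q)"
    using sw.v_P_high[OF q, unfolded swap_simps] by (simp only: add.assoc add.commute[of \<mu>2 \<mu>1])
  note low = sw.v_P_low[OF q, unfolded swap_simps]
  show ?thesis unfolding assms(7)
    by (intro conjI impI; elim conjE)
       (rule v_P_small[OF q] v_P_high[OF q] high v_P_low[OF q] low v_P_middle[OF q]; assumption)+
qed

end
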